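(* Let $\mathcal{R}$ be a good base of size $m$ (over $n$-bit strings) and let $d=\frac{n}{4\log m}-1$. Then $$\Pr_{r\leftarrow\mathcal{R}}\Big[\forall \varepsilon<\tfrac12,\ \forall p:\{0,1\}^m\to\mathbb{R} \text{ with } \deg(p)\le d,\ \exists y\in D_r:\ |p(y)-\mathsf{PUR}_r(y)|>\varepsilon\Big]\ge\frac23,$$ where $r$ is drawn uniformly at random from $\mathcal{R}$.
   Context: For $\tau\in\{0,1\}^n$ let $\mathcal{R}^\tau=\{v\in\{0,1\}^n: v_k=0 \text{ for every } k \text{ with } \tau_k=0\}$ (bits where $\tau_k=1$ are free). Let $\mathbf{1}_j\in\{0,1\}^n$ be the string with a 1 in position $j$ and 0 elsewhere. A good base of size $m=n+m'$ is a set of the form $\mathcal{R}=\{\mathbf{1}_1\}\times\cdots\times\{\mathbf{1}_n\}\times\mathcal{R}^{\tau^{(1)}}\times\cdots\times\mathcal{R}^{\tau^{(m')}}$ for some templates $\tau^{(1)},\dots,\tau^{(m')}\in\{0,1\}^n$; an element is an $m$-tuple $r=(r_1,\dots,r_m)$ of $n$-bit strings, and sampling $r$ uniformly from $\mathcal{R}$ means each $r_{n+j}$ is uniform on $\mathcal{R}^{\tau^{(j)}}$, independently. For $r\in\mathcal{R}$ and $x\in\{0,1\}^n$, $\mathcal{Y}(r,x)\in\{0,1\}^m$ is given by $\mathcal{Y}(r,x)_j=\langle r_j,x\rangle \bmod 2$. For fixed $r$, let $D_r=\{\mathcal{Y}(r,x): x\in\{0,1\}^n\}$ and let $\mathsf{PUR}_r:D_r\to\{0,1\}$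 be $\mathsf{PUR}_r(\mathcal{Y}(r,x))=\mathsf{parity}(x)=x_1\oplus\cdots\oplus x_n$ (well defined since the first $n$ coordinates of $\mathcal{Y}(r,x)$ equal $x$). Logarithms are base 2. *)

theory Defs
  imports "HOL-Probability.Probability_Mass_Function"
begin

text \<open>Bit strings are lists of Booleans; positions are numbered from 0.\<close>

definition bits :: "nat \<Rightarrow> bool list set" where
  "bits n = {v. length v = n}"

definition template_set :: "bool list \<Rightarrow> bool list set" where
  "template_set \<tau> = {v \<in> bits (length \<tau>). \<forall>k<length \<tau>. \<not> \<tau> ! k \<longrightarrow> \<not> v ! k}"

definition unit_string :: "nat \<Rightarrow> nat \<Rightarrow> bool list" where
  "unit_string n j = map (\<lambda>k. k = j) [0..<n]"

text \<open>The library function \<^const>\<open>listset\<close> is the Cartesian product of a list of sets.\<close>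

definition good_base :: "nat \<Rightarrow> nat \<Rightarrow> bool list list set \<Rightarrow> bool" where
  "good_base n m R \<longleftrightarrow> (\<exists>\<tau>s. set \<tau>s \<subseteq> bits n \<and> m = n + length \<tau>s \<and>
     R = listset (map (\<lambda>j. {unit_string n j}) [0..<n] @ map template_set \<tau>s))"

definition inner2 :: "bool list \<Rightarrow> bool list \<Rightarrow> bool" where
  "inner2 v x \<longleftrightarrow> odd (\<Sum>k<length x. of_bool (v ! k) * of_bool (x ! k) :: nat)"

definition parity :: "bool list \<Rightarrow> bool" where
  "parity x \<longleftrightarrow> odd (\<Sum>k<length x. of_bool (x ! k) :: nat)"

definition Y_string :: "bool list list \<Rightarrow> bool list \<Rightarrow> bool list" where
  "Y_string r x = map (\<lambda>v. inner2 v x) r"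

definition D_set :: "nat \<Rightarrow> bool list list \<Rightarrow> bool list set" where
  "D_set n r = Y_string r ` bits n"

text \<open>Only meaningful for arguments in \<^term>\<open>D_set n r\<close>, with \<^term>\<open>r\<close> in a good base;
  see \<open>PUR_Y_string\<close> below.\<close>

definition PUR :: "nat \<Rightarrow> bool list list \<Rightarrow> bool list \<Rightarrow> bool" where
  "PUR n r y = parity (THE x. x \<in> bits n \<and> Y_string r x = y)"

text \<open>A real multilinear polynomial in \<open>m\<close> variables is given by its coefficients, indexed by
  the sets of variables occurring in the monomials.\<close>

definition multilinear :: "nat \<Rightarrow> (nat set \<Rightarrow> real) \<Rightarrow> bool list \<Rightarrow> real" where
  "multilinear m c y = (\<Sum>S\<in>Pow {..<m}. c S * (\<Prod>i\<in>S. of_bool (y ! i)))"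

text \<open>The degree of a function on the cube is the degree of the multilinear polynomial
  representing it; that polynomial exists and is unique, see \<open>multilinear_exists\<close> and
  \<open>multilinear_unique\<close>. The zero function has degree 0, as for \<open>degree\<close> of univariate
  polynomials. Values of \<^term>\<open>p\<close> outside \<^term>\<open>bits m\<close> are ignored.\<close>

definition cube_degree :: "nat \<Rightarrow> (bool list \<Rightarrow> real) \<Rightarrow> nat" where
  "cube_degree m p = (LEAST k. \<exists>c. (\<forall>y\<in>bits m. p y = multilinear m c y) \<and>
     (\<forall>S\<in>Pow {..<m}. c S \<noteq> 0 \<longrightarrow> card S \<le> k))"

lemma multilinear_indicator:
  assumes "T \<subseteq> {..<m}"
  shows "multilinear m c (map (\<lambda>i. i \<in> T) [0..<m]) = (\<Sum>S\<in>Pow T. c S)"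
proof -
  have "(\<Prod>i\<in>S. of_bool (map (\<lambda>i. i \<in> T) [0..<m] ! i)) = (of_bool (S \<subseteq> T) :: real)"
    if "S \<subseteq> {..<m}" for S
  proof -
    have "finite S" using that finite_subset by blast
    have "(\<Prod>i\<in>S. of_bool (map (\<lambda>i. i \<in> T) [0..<m] ! i)) = (\<Prod>i\<in>S. of_bool (i \<in> T) :: real)"
      using that by (intro prod.cong) auto
    also have "\<dots> = of_bool (S \<subseteq> T)"
      using \<open>finite S\<close> by induction auto
    finally show ?thesis .
  qed
  hence "multilinear m c (map (\<lambda>i. i \<in> T) [0..<m]) = (\<Sum>S\<in>Pow {..<m}. c S * of_bool (S \<subseteq> T))"
    unfolding multilinear_def by (intro sum.cong) auto
  also have "\<dots> = (\<Sum>S\<in>Pow T. c S)"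
    using assms by (intro sum.mono_neutral_cong_right) auto
  finally show ?thesis .
qed

lemma bits_indicator:
  assumes "y \<in> bits m"
  obtains T where "T \<subseteq> {..<m}" "y = map (\<lambda>i. i \<in> T) [0..<m]"
proof
  show "{i. i < m \<and> y ! i} \<subseteq> {..<m}" by auto
  show "y = map (\<lambda>i. i \<in> {i. i < m \<and> y ! i}) [0..<m]"
    using assms by (intro nth_equalityI) (auto simp: bits_def)
qed

lemma subset_sums_exist:
  "\<exists>c :: nat set \<Rightarrow> real. \<forall>T\<subseteq>{..<m}. f T = (\<Sum>S\<in>Pow T. c S)"
proof (induction m arbitrary: f)
  case 0
  show ?case by (intro exI[of _ f]) auto
next
  case (Suc m)
  obtain c0 where c0: "\<And>T. T \<subseteq> {..<m} \<Longrightarrow> f T = (\<Sum>S\<in>Pow T. c0 S)"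
    using Suc.IH[of f] by blast
  obtain c1 where c1: "\<And>T. T \<subseteq> {..<m} \<Longrightarrow> f (insert m T) - f T = (\<Sum>S\<in>Pow T. c1 S)"
    using Suc.IH[of "\<lambda>T. f (insert m T) - f T"] by blast
  define c where "c S = (if m \<in> S then c1 (S - {m}) else c0 S)" for S
  have low: "(\<Sum>S\<in>Pow T. c S) = f T" if "T \<subseteq> {..<m}" for T
    unfolding c0[OF that] by (intro sum.cong) (use that in \<open>auto simp: c_def\<close>)
  have "f T = (\<Sum>S\<in>Pow T. c S)" if T: "T \<subseteq> {..<Suc m}" for T
  proof (cases "m \<in> T")
    case False
    hence "T \<subseteq> {..<m}" using T by (auto simp: lessThan_Suc)
    thus ?thesis using low by simp
  next
    case True
    define U where "U = T - {m}"
    have U: "U \<subseteq> {..<m}" "m \<notin> U" "T = insert m U" "finite U"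
      using T True by (auto simp: U_def lessThan_Suc intro: finite_subset)
    have "(\<Sum>S\<in>Pow T. c S) = (\<Sum>S\<in>Pow U. c S) + (\<Sum>S\<in>insert m ` Pow U. c S)"
      unfolding U(3) Pow_insert using U by (intro sum.union_disjoint) auto
    also have "(\<Sum>S\<in>insert m ` Pow U. c S) = (\<Sum>S\<in>Pow U. c (insert m S))"
      by (subst sum.reindex) (use U(2) in \<open>auto simp: inj_on_def\<close>)
    also have "\<dots> = (\<Sum>S\<in>Pow U. c1 S)"
      using U(2) by (intro sum.cong) (auto simp: c_def intro!: arg_cong[of _ _ c1])
    also have "\<dots> = f T - f U" using c1[OF U(1)] U(3) by simp
    finally show ?thesis using low[OF U(1)] by simp
  qed
  thus ?case by blast
qed

lemma multilinear_exists: "\<exists>c. \<forall>y\<in>bits m. p y = multilinear m c y"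
proof -
  obtain c where c: "\<And>T. T \<subseteq> {..<m} \<Longrightarrow> p (map (\<lambda>i. i \<in> T) [0..<m]) = (\<Sum>S\<in>Pow T. c S)"
    using subset_sums_exist[of m "\<lambda>T. p (map (\<lambda>i. i \<in> T) [0..<m])"] by blast
  have "p y = multilinear m c y" if "y \<in> bits m" for y
    using that by (elim bits_indicator) (simp add: multilinear_indicator c)
  thus ?thesis by blast
qed

lemma multilinear_unique:
  assumes eq: "\<forall>y\<in>bits m. multilinear m c y = multilinear m c' y" and "T \<subseteq> {..<m}"
  shows "c T = c' T"
proof -
  have "finite T" using assms(2) finite_subset by blast
  thus ?thesis using assms(2)
  proof (induction T rule: finite_psubset_induct)
    case (psubset T)
    have "(\<Sum>S\<in>Pow T. c S) = (\<Sum>S\<in>Pow T. c' S)"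
      using eq psubset.prems by (simp flip: multilinear_indicator add: bits_def)
    moreover have "(\<Sum>S\<in>Pow T - {T}. c S) = (\<Sum>S\<in>Pow T - {T}. c' S)"
      using psubset by (intro sum.cong) auto
    ultimately show ?case
      using psubset.hyps by (simp add: sum.remove[of "Pow T" T])
  qed
qed

lemma in_listset_iff: "xs \<in> listset As \<longleftrightarrow> list_all2 (\<in>) xs As"
  by (induction As arbitrary: xs) (auto simp: set_Cons_def list_all2_Cons2)

lemma inner2_unit_string:
  assumes "x \<in> bits n" "j < n"
  shows "inner2 (unit_string n j) x = x ! j"
proof -
  have "(\<Sum>k<length x. of_bool (unit_string n j ! k) * of_bool (x ! k)) =
      (\<Sum>k<n. if k = j then of_bool (x ! k) else (0::nat))"
    using assms by (intro sum.cong) (auto simp: bits_def unit_string_def)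
  thus ?thesis using assms by (simp add: inner2_def)
qed

lemma take_Y_string:
  assumes "good_base n m R" "r \<in> R" "x \<in> bits n"
  shows "take n (Y_string r x) = x"
proof -
  obtain \<tau>s where "list_all2 (\<in>) r
      (map (\<lambda>j. {unit_string n j}) [0..<n] @ map template_set \<tau>s)"
    using assms by (auto simp: good_base_def in_listset_iff)
  hence r: "length r = n + length \<tau>s" "\<And>j. j < n + length \<tau>s \<Longrightarrow>
      r ! j \<in> (map (\<lambda>j. {unit_string n j}) [0..<n] @ map template_set \<tau>s) ! j"
    by (auto simp: list_all2_conv_all_nth)
  have "length r \<ge> n" using r(1) by simp
  moreover have "r ! j = unit_string n j" if "j < n" for j
    using r(2)[of j] that by (simp add: nth_append)
  ultimately show ?thesis using assms(3)
    by (intro nth_equalityI) (auto simp: Y_string_def bits_def inner2_unit_string)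
qed

lemma PUR_Y_string:
  assumes "good_base n m R" "r \<in> R" "x \<in> bits n"
  shows "PUR n r (Y_string r x) = parity x"
proof -
  have "(THE x'. x' \<in> bits n \<and> Y_string r x' = Y_string r x) = x"
    using assms(3) take_Y_string[OF assms(1,2)] by (intro the_equality) metis+
  thus ?thesis by (simp add: PUR_def)
qed

lemma good_base_finite:
  assumes "good_base n m R"
  shows "finite R" "R \<noteq> {}"
proof -
  obtain \<tau>s where R: "R = listset (map (\<lambda>j. {unit_string n j}) [0..<n] @ map template_set \<tau>s)"
    using assms by (auto simp: good_base_def)
  have "finite (bits k)" for k
    using finite_lists_length_eq[of "UNIV :: bool set" k] by (simp add: bits_def)
  hence ft: "finite (template_set \<tau>)" for \<tau> by (simp add: template_set_def)
  have nt: "\<tau> \<in> template_set \<tau>" for \<tau> by (simp add: template_set_def bits_def)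
  have fin: "finite (listset As)" if "\<forall>A\<in>set As. finite A" for As :: "bool list set list"
    using that
  proof (induction As)
    case (Cons A As)
    have "set_Cons A (listset As) = (\<lambda>(x, xs). x # xs) ` (A \<times> listset As)"
      by (auto simp: set_Cons_def)
    thus ?case using Cons by simp
  qed simp
  have ne: "listset As \<noteq> {}" if "\<forall>A\<in>set As. A \<noteq> {}" for As :: "bool list set list"
    using that by (induction As) (auto simp: set_Cons_def)
  show "finite R"
    unfolding R by (intro fin) (auto simp: ft)
  have "template_set \<tau> \<noteq> {}" for \<tau> using nt by blast
  thus "R \<noteq> {}"
    unfolding R by (intro ne) auto
qed

end

theory Submission
  imports Defs
begin

text \<open>A monomial of degree at most \<open>k\<close> in the bits of
  \<open>Y_string r x\<close> is a linear combination of characters of \<open>x\<close>, namely of the products of the signs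
  of the inner products of \<open>x\<close> with the \<open>r ! j\<close>, for \<open>j\<close> in a set \<open>S\<close> of size at most \<open>k\<close>. Such a
  character is orthogonal to the parity of \<open>x\<close> unless the strings \<open>r ! j\<close> with \<open>j \<in> S\<close> add up to the
  all-ones string modulo 2. If no small \<open>S\<close> has that property, every polynomial of low degree is
  uncorrelated with the parity, so it cannot be within \<open>\<epsilon> < 1/2\<close> of it everywhere. Finally, for a
  fixed \<open>S\<close> the property has probability at most \<open>2 ^ (card S - n)\<close>, because at a position outside
  of \<open>S\<close> the unit strings contribute nothing, so the bit of the sum there is 0 or a uniformly random
  bit, independently over these positions. A union bound over the small \<open>S\<close> finishes.\<close>

section \<open>Signs, characters of the cube and their correlation with parity\<close>

definition bit_sign :: "bool \<Rightarrow> real" where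
  "bit_sign b = (if b then -1 else 1)"

text \<open>Sums modulo 2 are written as products of signs because in this form they appear as
  factors of character sums.\<close>

definition sums_to_ones :: "nat \<Rightarrow> nat set \<Rightarrow> bool list list \<Rightarrow> bool" where
  "sums_to_ones n S r \<longleftrightarrow> (\<forall>k<n. (\<Prod>j\<in>S. bit_sign (r ! j ! k)) = -1)"

lemma bit_sign_xor: "bit_sign (a \<noteq> b) = bit_sign a * bit_sign b"
  by (auto simp: bit_sign_def)

lemma bit_sign_eq_iff [simp]: "bit_sign a = bit_sign b \<longleftrightarrow> a = b"
  by (auto simp: bit_sign_def)

lemma of_bool_eq_bit_sign: "of_bool b = 1/2 + (-1/2) * bit_sign b"
  by (auto simp: bit_sign_def)

lemma prod_bit_sign_cases: "(\<Prod>j\<in>S. bit_sign (f j)) = 1 \<or> (\<Prod>j\<in>S. bit_sign (f j)) = -1"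
  by (induction S rule: infinite_finite_induct) (auto simp: bit_sign_def)

lemma bit_sign_odd_sum:
  "bit_sign (odd (\<Sum>k\<in>A. of_bool (P k) :: nat)) = (\<Prod>k\<in>A. bit_sign (P k))"
  by (induction A rule: infinite_finite_induct) (auto simp: bit_sign_def)

lemma bit_sign_parity: "bit_sign (parity x) = (\<Prod>k<length x. bit_sign (x ! k))"
  unfolding parity_def by (rule bit_sign_odd_sum)

lemma bit_sign_inner2: "bit_sign (inner2 v x) = (\<Prod>k<length x. bit_sign (v ! k \<and> x ! k))"
  unfolding inner2_def by (simp flip: of_bool_conj bit_sign_odd_sum)

text \<open>Distributivity: choosing one summand from each factor on the right amounts to choosing a
  bit string.\<close>

lemma sum_bits_prod:
  fixes f :: "nat \<Rightarrow> bool \<Rightarrow> 'a :: comm_semiring_1"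
  shows "(\<Sum>x\<in>bits n. \<Prod>k<n. f k (x ! k)) = (\<Prod>k<n. f k True + f k False)"
proof -
  have "(\<Sum>x\<in>bits n. \<Prod>k<n. f k (x ! k)) = (\<Sum>B\<in>Pow {..<n}. \<Prod>k<n. f k (k \<in> B))"
    by (rule sum.reindex_bij_witness[where i = "\<lambda>B. map (\<lambda>k. k \<in> B) [0..<n]"
          and j = "\<lambda>x. {k. k < n \<and> x ! k}"])
       (auto simp: bits_def intro!: nth_equalityI prod.cong)
  also have "\<dots> = (\<Sum>B\<in>Pow {..<n}. (\<Prod>k\<in>B. f k True) * (\<Prod>k\<in>{..<n} - B. f k False))"
  proof (rule sum.cong[OF refl])
    fix B assume "B \<in> Pow {..<n}"
    hence "(\<Prod>k<n. f k (k \<in> B)) = (\<Prod>k\<in>{..<n} - B. f k (k \<in> B)) * (\<Prod>k\<in>B. f k (k \<in> B))"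
      by (intro prod.subset_diff) auto
    also have "(\<Prod>k\<in>{..<n} - B. f k (k \<in> B)) = (\<Prod>k\<in>{..<n} - B. f k False)"
      by (intro prod.cong) auto
    also have "(\<Prod>k\<in>B. f k (k \<in> B)) = (\<Prod>k\<in>B. f k True)"
      by (intro prod.cong) auto
    finally show "(\<Prod>k<n. f k (k \<in> B)) = (\<Prod>k\<in>B. f k True) * (\<Prod>k\<in>{..<n} - B. f k False)"
      by (simp add: mult.commute)
  qed
  also have "\<dots> = (\<Prod>k<n. f k True + f k False)"
    by (simp add: prod_add)
  finally show ?thesis .
qed

text \<open>The sum factors over the positions into the terms \<open>1 - a k\<close>, where
  \<open>a k\<close> is the sign of bit \<open>k\<close> of the sum of the rows in \<open>S\<close>.
  A position where that bit is 0 kills the product.\<close>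

lemma sum_characters_parity_eq_0:
  assumes "S \<subseteq> {..<length r}" "\<not> sums_to_ones n S r"
  shows "(\<Sum>x\<in>bits n. (\<Prod>j\<in>S. bit_sign (Y_string r x ! j)) * bit_sign (parity x)) = 0"
proof -
  define a where "a k = (\<Prod>j\<in>S. bit_sign (r ! j ! k))" for k
  obtain k where k: "k < n" "a k = 1"
    using assms(2) prod_bit_sign_cases by (fastforce simp: sums_to_ones_def a_def)
  have "(\<Prod>j\<in>S. bit_sign (Y_string r x ! j)) * bit_sign (parity x)
      = (\<Prod>k<n. (if x ! k then a k else 1) * bit_sign (x ! k))" if "x \<in> bits n" for x
  proof -
    have [simp]: "length x = n" using that by (simp add: bits_def)
    have "(\<Prod>j\<in>S. bit_sign (Y_string r x ! j)) = (\<Prod>j\<in>S. \<Prod>k<n. bit_sign (r ! j ! k \<and> x ! k))"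
      using assms(1) by (intro prod.cong) (auto simp: Y_string_def bit_sign_inner2)
    also have "\<dots> = (\<Prod>k<n. \<Prod>j\<in>S. bit_sign (r ! j ! k \<and> x ! k))"
      by (rule prod.swap)
    also have "\<dots> = (\<Prod>k<n. if x ! k then a k else 1)"
      by (intro prod.cong) (auto simp: a_def bit_sign_def)
    finally show ?thesis by (simp add: bit_sign_parity prod.distrib)
  qed
  hence "(\<Sum>x\<in>bits n. (\<Prod>j\<in>S. bit_sign (Y_string r x ! j)) * bit_sign (parity x))
      = (\<Sum>x\<in>bits n. \<Prod>k<n. (if x ! k then a k else 1) * bit_sign (x ! k))"
    by (intro sum.cong) auto
  also have "\<dots> = (\<Prod>k<n. a k * bit_sign True + bit_sign False)"
    by (subst sum_bits_prod[where f = "\<lambda>k b. (if b then a k else 1) * bit_sign b"]) simp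
  also have "\<dots> = 0"
    using k by (auto simp: bit_sign_def intro!: bexI[of _ k])
  finally show ?thesis .
qed

text \<open>Replacing each bit by 1/2 minus half its sign expands the monomial into characters of
  all subsets of \<open>S\<close>, each orthogonal to parity.\<close>

lemma sum_monomial_parity_eq_0:
  assumes "S \<subseteq> {..<length r}" "\<And>T. T \<subseteq> S \<Longrightarrow> \<not> sums_to_ones n T r"
  shows "(\<Sum>x\<in>bits n. (\<Prod>i\<in>S. of_bool (Y_string r x ! i)) * bit_sign (parity x)) = 0"
proof -
  have "finite S" using assms(1) finite_subset by blast
  define b :: "nat set \<Rightarrow> real" where "b T = (1/2) ^ card (S - T) * (-1/2) ^ card T" for T
  have expand: "(\<Prod>i\<in>S. of_bool (y ! i)) = (\<Sum>T\<in>Pow S. b T * (\<Prod>i\<in>T. bit_sign (y ! i)))"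
    for y :: "bool list"
  proof -
    have "(\<Prod>i\<in>S. of_bool (y ! i)) = (\<Prod>i\<in>S. (-1/2) * bit_sign (y ! i) + 1/2)"
      by (simp add: of_bool_eq_bit_sign algebra_simps)
    also have "\<dots> = (\<Sum>T\<in>Pow S. (\<Prod>i\<in>T. (-1/2) * bit_sign (y ! i)) * (\<Prod>i\<in>S - T. 1/2))"
      by (rule prod_add[OF \<open>finite S\<close>])
    also have "\<dots> = (\<Sum>T\<in>Pow S. b T * (\<Prod>i\<in>T. bit_sign (y ! i)))"
      by (intro sum.cong) (simp_all only: prod.distrib prod_constant b_def mult_ac)
    finally show ?thesis .
  qed
  have "(\<Sum>x\<in>bits n. (\<Prod>i\<in>S. of_bool (Y_string r x ! i)) * bit_sign (parity x))
     = (\<Sum>T\<in>Pow S. b T *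
         (\<Sum>x\<in>bits n. (\<Prod>i\<in>T. bit_sign (Y_string r x ! i)) * bit_sign (parity x)))"
    unfolding expand sum_distrib_right sum_distrib_left mult.assoc by (rule sum.swap)
  also have "\<dots> = 0"
    using assms by (intro sum.neutral ballI) (subst sum_characters_parity_eq_0, auto)
  finally show ?thesis .
qed

lemma sum_multilinear_parity_eq_0:
  assumes "length r = m"
    and "\<And>S. S \<subseteq> {..<m} \<Longrightarrow> c S \<noteq> 0 \<Longrightarrow> card S \<le> k"
    and "\<And>S. S \<subseteq> {..<m} \<Longrightarrow> card S \<le> k \<Longrightarrow> \<not> sums_to_ones n S r"
  shows "(\<Sum>x\<in>bits n. multilinear m c (Y_string r x) * bit_sign (parity x)) = 0"
proof -
  have "(\<Sum>x\<in>bits n. multilinear m c (Y_string r x) * bit_sign (parity x))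
     = (\<Sum>S\<in>Pow {..<m}. c S *
         (\<Sum>x\<in>bits n. (\<Prod>i\<in>S. of_bool (Y_string r x ! i)) * bit_sign (parity x)))"
    unfolding multilinear_def sum_distrib_right sum_distrib_left mult.assoc by (rule sum.swap)
  also have "\<dots> = 0"
  proof (intro sum.neutral ballI)
    fix S assume S: "S \<in> Pow {..<m}"
    show "c S * (\<Sum>x\<in>bits n. (\<Prod>i\<in>S. of_bool (Y_string r x ! i)) * bit_sign (parity x)) = 0"
    proof (cases "c S = 0")
      case False
      have "\<not> sums_to_ones n T r" if "T \<subseteq> S" for T
      proof -
        have "finite S" using S finite_subset by blast
        hence "card T \<le> k" using assms(2)[of S] S False card_mono[OF _ that] by fastforce
        thus ?thesis using assms(3)[of T] S that by blast
      qed
      thus ?thesis using S assms(1) by (subst sum_monomial_parity_eq_0) auto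
    qed simp
  qed
  finally show ?thesis .
qed

section \<open>Degree, coordinates of a good base, and inapproximability\<close>

text \<open>The \<open>LEAST\<close> in \<open>cube_degree\<close> is attained, since
  \<open>m\<close> bounds the size of every monomial.\<close>

lemma cube_degree_witness:
  obtains c where "\<forall>y\<in>bits m. p y = multilinear m c y"
    "\<And>S. S \<subseteq> {..<m} \<Longrightarrow> c S \<noteq> 0 \<Longrightarrow> card S \<le> cube_degree m p"
proof -
  obtain c where c: "\<forall>y\<in>bits m. p y = multilinear m c y"
    using multilinear_exists by blast
  have "\<forall>S\<in>Pow {..<m}. c S \<noteq> 0 \<longrightarrow> card S \<le> m"
    using card_mono[of "{..<m}"] by auto
  hence "\<exists>k. \<exists>c. (\<forall>y\<in>bits m. p y = multilinear m c y) \<and>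
      (\<forall>S\<in>Pow {..<m}. c S \<noteq> 0 \<longrightarrow> card S \<le> k)"
    using c by blast
  from LeastI_ex[OF this] show ?thesis
    using that unfolding cube_degree_def[symmetric] by blast
qed

lemma good_base_iff_nth:
  assumes "good_base n m R"
  obtains \<tau>s where "n \<le> m" "\<And>r. r \<in> R \<longleftrightarrow> length r = m \<and> (\<forall>j<n. r ! j = unit_string n j) \<and>
     (\<forall>j\<in>{n..<m}. length (r ! j) = n \<and> (\<forall>k<n. \<not> \<tau>s ! (j - n) ! k \<longrightarrow> \<not> r ! j ! k))"
proof -
  obtain \<tau>s where \<tau>s: "set \<tau>s \<subseteq> bits n" "m = n + length \<tau>s"
     "R = listset (map (\<lambda>j. {unit_string n j}) [0..<n] @ map template_set \<tau>s)"
    using assms by (auto simp: good_base_def)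
  have len: "length (\<tau>s ! i) = n" if "i < length \<tau>s" for i
    using \<tau>s(1) that nth_mem by (fastforce simp: bits_def)
  have "r \<in> R \<longleftrightarrow> length r = m \<and> (\<forall>j<n. r ! j = unit_string n j) \<and>
     (\<forall>j\<in>{n..<m}. length (r ! j) = n \<and> (\<forall>k<n. \<not> \<tau>s ! (j - n) ! k \<longrightarrow> \<not> r ! j ! k))" for r
  proof -
    have "r \<in> R \<longleftrightarrow> length r = m \<and> (\<forall>j<m. r ! j \<in>
        (if j < n then {unit_string n j} else template_set (\<tau>s ! (j - n))))"
      unfolding \<tau>s(3) in_listset_iff list_all2_conv_all_nth using \<tau>s(2)
      by (auto simp: nth_append)
    also have "\<dots> \<longleftrightarrow> length r = m \<and> (\<forall>j<n. r ! j = unit_string n j) \<and>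
        (\<forall>j\<in>{n..<m}. r ! j \<in> template_set (\<tau>s ! (j - n)))"
      using \<tau>s(2) by (auto simp: not_less)
    also have "\<dots> \<longleftrightarrow> length r = m \<and> (\<forall>j<n. r ! j = unit_string n j) \<and>
        (\<forall>j\<in>{n..<m}. length (r ! j) = n \<and> (\<forall>k<n. \<not> \<tau>s ! (j - n) ! k \<longrightarrow> \<not> r ! j ! k))"
    proof -
      have "v \<in> template_set (\<tau>s ! (j - n)) \<longleftrightarrow>
          length v = n \<and> (\<forall>k<n. \<not> \<tau>s ! (j - n) ! k \<longrightarrow> \<not> v ! k)" if "j \<in> {n..<m}" for j v
        using len[of "j - n"] \<tau>s(2) that by (auto simp: template_set_def bits_def)
      thus ?thesis by (intro arg_cong2[of _ _ _ _ "(\<and>)"] ball_cong refl)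
    qed
    finally show ?thesis .
  qed
  thus ?thesis using that[of \<tau>s] \<tau>s(2) by simp
qed

text \<open>An error below 1/2 everywhere would give \<open>1 - 2 * p\<close> the sign of the parity
  character at every point, hence positive correlation with it, while orthogonality makes the
  correlation 0.\<close>

lemma PUR_inapproximable:
  assumes gb: "good_base n m R" and r: "r \<in> R"
    and none: "\<And>S. S \<subseteq> {..<m} \<Longrightarrow> card S \<le> k \<Longrightarrow> \<not> sums_to_ones n S r"
    and deg: "cube_degree m p \<le> k" and \<epsilon>: "\<epsilon> < 1/2"
  shows "\<exists>y\<in>D_set n r. \<bar>p y - of_bool (PUR n r y)\<bar> > \<epsilon>"
proof (rule ccontr)
  assume "\<not> ?thesis"
  hence close: "\<bar>p (Y_string r x) - of_bool (parity x)\<bar> \<le> \<epsilon>" if "x \<in> bits n" for x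
    using that PUR_Y_string[OF gb r that] by (force simp: D_set_def)
  have len: "length r = m"
    by (rule good_base_iff_nth[OF gb]) (use r in blast)
  obtain c where c: "\<forall>y\<in>bits m. p y = multilinear m c y"
      "\<And>S. S \<subseteq> {..<m} \<Longrightarrow> c S \<noteq> 0 \<Longrightarrow> card S \<le> cube_degree m p"
    using cube_degree_witness by blast
  have "(\<Sum>x\<in>bits n. multilinear m c (Y_string r x) * bit_sign (parity x)) = 0"
    by (rule sum_multilinear_parity_eq_0[OF len order.trans[OF c(2) deg] none])
  hence "(\<Sum>x\<in>bits n. p (Y_string r x) * bit_sign (parity x)) = 0"
    using c(1) len by (simp add: bits_def Y_string_def)
  \<comment> \<open>The constant 1 is the character of the empty set; \<open>none\<close> for that
    set also excludes \<open>n = 0\<close>.\<close>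
  moreover have "(\<Sum>x\<in>bits n. bit_sign (parity x)) = 0"
    using sum_characters_parity_eq_0[of "{}" r n] none[of "{}"] by simp
  ultimately have "(\<Sum>x\<in>bits n. (1 - 2 * p (Y_string r x)) * bit_sign (parity x)) = 0"
    by (simp add: left_diff_distrib sum_subtractf mult.assoc flip: sum_distrib_left)
  moreover have "(\<Sum>x\<in>bits n. (1 - 2 * p (Y_string r x)) * bit_sign (parity x)) > 0"
  proof (rule sum_pos)
    show "finite (bits n)"
      using finite_lists_length_eq[of "UNIV :: bool set" n] by (simp add: bits_def)
    show "bits n \<noteq> {}"
      by (auto simp: bits_def intro: exI[of _ "replicate n True"])
    show "(1 - 2 * p (Y_string r x)) * bit_sign (parity x) > 0" if "x \<in> bits n" for x
      using close[OF that] \<epsilon> by (auto simp: bit_sign_def split: if_splits)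
  qed
  ultimately show False by simp
qed

section \<open>Counting the tuples whose rows in a fixed set sum to the all-ones string\<close>

text \<open>Given one \<open>r\<close> with \<open>sums_to_ones n S r\<close>, each position \<open>k \<notin> S\<close> has a row \<open>g k \<in> S\<close> in which bit
  \<open>k\<close> is free. Flipping these bits for the \<open>k\<close> in any set \<open>W\<close> of positions outside of \<open>S\<close> stays in
  \<open>R\<close>, and \<open>W\<close> can be read off the resulting sum.\<close>

lemma card_sums_to_ones:
  assumes gb: "good_base n m R" and S: "S \<subseteq> {..<m}"
  shows "card {r \<in> R. sums_to_ones n S r} * 2 ^ (n - card S) \<le> card R"
proof (cases "{r \<in> R. sums_to_ones n S r} = {}")
  \<comment> \<open>This case is separate because \<open>g\<close> is extracted from a member
    \<open>r0\<close>.\<close>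
  case True
  thus ?thesis by (simp only: card.empty)
next
  case False
  obtain \<tau>s where "n \<le> m" and R: "\<And>r. r \<in> R \<longleftrightarrow> length r = m \<and> (\<forall>j<n. r ! j = unit_string n j) \<and>
     (\<forall>j\<in>{n..<m}. length (r ! j) = n \<and> (\<forall>k<n. \<not> \<tau>s ! (j - n) ! k \<longrightarrow> \<not> r ! j ! k))"
    by (rule good_base_iff_nth[OF gb]) (rule that)
  have "finite S" using S finite_subset by blast
  obtain r0 where r0: "r0 \<in> R" "sums_to_ones n S r0" using False by blast
  have "\<exists>j\<in>S. n \<le> j \<and> \<tau>s ! (j - n) ! k" if k: "k \<in> {..<n} - S" for k
  proof -
    have "(\<Prod>j\<in>S. bit_sign (r0 ! j ! k)) \<noteq> 1" using r0(2) k by (auto simp: sums_to_ones_def)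
    then obtain j where j: "j \<in> S" "r0 ! j ! k"
      by (metis (no_types, lifting) bit_sign_def prod.neutral)
    \<comment> \<open>A unit row \<open>j\<close> has its only one at position \<open>j\<close>,
      which is in \<open>S\<close>, whereas \<open>k\<close> is not.\<close>
    have "n \<le> j"
    proof (rule ccontr)
      assume "\<not> n \<le> j"
      hence "r0 ! j = unit_string n j" using r0(1) R by simp
      hence "k = j" using j(2) k by (simp add: unit_string_def)
      thus False using j(1) k by simp
    qed
    moreover have "\<tau>s ! (j - n) ! k"
      using r0(1) j S \<open>n \<le> j\<close> k unfolding R by fastforce
    ultimately show ?thesis using j(1) by blast
  qed
  then obtain g where g: "\<And>k. k \<in> {..<n} - S \<Longrightarrow> g k \<in> S \<and> n \<le> g k \<and> \<tau>s ! (g k - n) ! k"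
    by metis
  define flip where "flip W r =
    map (\<lambda>j. map (\<lambda>k. r ! j ! k \<noteq> (k \<in> W \<and> g k = j)) [0..<n]) [0..<m]"
    for W :: "nat set" and r :: "bool list list"
  have lens: "length r = m" "\<And>j. j < m \<Longrightarrow> length (r ! j) = n" if "r \<in> R" for r
    using that unfolding R by (auto simp: unit_string_def)
  have flip_nth: "flip W r ! j ! k \<longleftrightarrow> r ! j ! k \<noteq> (k \<in> W \<and> g k = j)"
    if "j < m" "k < n" for W r j k
    using that by (simp add: flip_def)
  have flip_in: "flip W r \<in> R" if W: "W \<subseteq> {..<n} - S" and r: "r \<in> R" for W r
    unfolding R
  proof (intro conjI allI impI ballI)
    show "length (flip W r) = m" by (simp add: flip_def)
    show "flip W r ! j = unit_string n j" if j: "j < n" for j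
    proof -
      have "r ! j = unit_string n j" using r j R by simp
      moreover have "g k \<noteq> j" if "k \<in> W" for k using g[of k] W that j by fastforce
      ultimately show ?thesis using j \<open>n \<le> m\<close>
        by (intro nth_equalityI) (auto simp: flip_def unit_string_def)
    qed
    fix j assume j: "j \<in> {n..<m}"
    thus "length (flip W r ! j) = n" by (simp add: flip_def)
    fix k assume k: "k < n" "\<not> \<tau>s ! (j - n) ! k"
    have "\<not> r ! j ! k" using r j k unfolding R by blast
    moreover have "\<not> (k \<in> W \<and> g k = j)" using g[of k] W k by auto
    ultimately show "\<not> flip W r ! j ! k" using j k by (simp add: flip_nth)
  qed
  have flip_sum: "(\<Prod>j\<in>S. bit_sign (flip W r ! j ! k)) = bit_sign (k \<notin> W)"
    if "W \<subseteq> {..<n} - S" "sums_to_ones n S r" "k < n" for W r k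
  proof -
    have "(\<Prod>j\<in>S. bit_sign (flip W r ! j ! k)) =
        (\<Prod>j\<in>S. bit_sign (r ! j ! k) * bit_sign (k \<in> W \<and> g k = j))"
      using S that(3) by (intro prod.cong) (auto simp: flip_nth simp flip: bit_sign_xor)
    also have "\<dots> = - (\<Prod>j\<in>S. bit_sign (k \<in> W \<and> g k = j))"
      using that(2,3) by (simp add: prod.distrib sums_to_ones_def)
    \<comment> \<open>For \<open>k\<close> in \<open>W\<close>, only row \<open>g k\<close> is
      flipped at \<open>k\<close>, and it lies in \<open>S\<close>; for other \<open>k\<close> every
      factor is 1.\<close>
    also have "(\<Prod>j\<in>S. bit_sign (k \<in> W \<and> g k = j)) =
        (\<Prod>j\<in>S. if g k = j then bit_sign (k \<in> W) else 1)"
      by (intro prod.cong) (auto simp: bit_sign_def)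
    also have "\<dots> = bit_sign (k \<in> W)"
      using \<open>finite S\<close> g[of k] that(1) by (auto simp: bit_sign_def)
    finally show ?thesis by (simp add: bit_sign_def)
  qed
  have "inj_on (\<lambda>(r, W). flip W r) ({r \<in> R. sums_to_ones n S r} \<times> Pow ({..<n} - S))"
  proof (rule inj_onI, clarify)
    fix r W r' W'
    assume r: "r \<in> R" "sums_to_ones n S r" and r': "r' \<in> R" "sums_to_ones n S r'"
      and W: "W \<subseteq> {..<n} - S" and W': "W' \<subseteq> {..<n} - S" and eq: "flip W r = flip W' r'"
    \<comment> \<open>\<open>W\<close> consists of the positions where the flipped rows in
      \<open>S\<close> sum to 0. Once \<open>W\<close> is known, undoing the flips recovers
      \<open>r\<close>.\<close>
    have "k \<in> W \<longleftrightarrow> k \<in> W'" if "k < n" for k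
      using flip_sum[OF W r(2) that] flip_sum[OF W' r'(2) that] eq by simp
    hence "W = W'" using W W' by blast
    moreover have "r ! j ! k = r' ! j ! k" if "j < m" "k < n" for j k
      using flip_nth[OF that, of W r] flip_nth[OF that, of W r'] eq \<open>W = W'\<close> by auto
    hence "r = r'"
      using lens[OF r(1)] lens[OF r'(1)] by (intro nth_equalityI) auto
    ultimately show "r = r' \<and> W = W'" by simp
  qed
  hence "card ({r \<in> R. sums_to_ones n S r} \<times> Pow ({..<n} - S)) \<le> card R"
    by (rule card_inj_on_le) (use flip_in good_base_finite[OF gb] in auto)
  hence "card {r \<in> R. sums_to_ones n S r} * 2 ^ card ({..<n} - S) \<le> card R"
    by (simp add: card_cartesian_product card_Pow)
  \<comment> \<open>Only an inequality, as \<open>S\<close> may contain indices beyond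
    \<open>n\<close>.\<close>
  moreover have "n - card S \<le> card ({..<n} - S)"
    using diff_card_le_card_Diff[OF \<open>finite S\<close>, of "{..<n}"] by simp
  hence "(2::nat) ^ (n - card S) \<le> 2 ^ card ({..<n} - S)" by simp
  ultimately show ?thesis by (meson le_trans mult_le_mono2)
qed

section \<open>Counting small sets and the union bound\<close>

text \<open>A small set is listed and padded to length exactly \<open>k\<close> with the dummy
  \<open>m\<close>, which the intersection with \<open>{..<m}\<close> removes.\<close>

lemma card_small_subsets: "card {S. S \<subseteq> {..<m} \<and> card S \<le> k} \<le> (m + 1) ^ k"
proof -
  have "{S. S \<subseteq> {..<m} \<and> card S \<le> k} \<subseteq>
      (\<lambda>xs. set xs \<inter> {..<m}) ` {xs. set xs \<subseteq> {..m} \<and> length xs = k}"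
  proof clarify
    fix S assume S: "S \<subseteq> {..<m}" "card S \<le> k"
    define xs where "xs = sorted_list_of_set S @ replicate (k - card S) m"
    have "finite S" using S(1) finite_subset by blast
    hence "S = set xs \<inter> {..<m}" "set xs \<subseteq> {..m}" "length xs = k"
      using S by (auto simp: xs_def)
    thus "S \<in> (\<lambda>xs. set xs \<inter> {..<m}) ` {xs. set xs \<subseteq> {..m} \<and> length xs = k}"
      by blast
  qed
  hence "card {S. S \<subseteq> {..<m} \<and> card S \<le> k} \<le> card {xs. set xs \<subseteq> {..m} \<and> length xs = k}"
    by (rule surj_card_le[rotated]) (simp add: finite_lists_length_eq)
  thus ?thesis by (simp add: card_lists_length_eq)
qed

text \<open>Bounding 3 and \<open>m + 1\<close> by \<open>m ^ 2\<close>, and 2 by \<open>m\<close>,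
  gives the exponent \<open>3 * k + 2\<close>, at most \<open>4 * (k + 1)\<close>. The 3 yields
  failure probability at most 1/3.\<close>

lemma union_bound_arith:
  fixes m n k :: nat
  assumes "m \<ge> 2" and "m ^ (4 * (k + 1)) \<le> 2 ^ n"
  shows "3 * (m + 1) ^ k \<le> 2 ^ (n - k)"
proof -
  have "2 * m \<le> m ^ 2"
    using assms(1) by (simp add: power2_eq_square)
  hence sq: "m + 1 \<le> m ^ 2" "3 \<le> m ^ 2" using assms(1) by linarith+
  have "3 * (m + 1) ^ k * 2 ^ k \<le> m ^ 2 * (m ^ 2) ^ k * m ^ k"
    using assms(1) sq by (intro mult_le_mono power_mono) auto
  also have "\<dots> = m ^ (3 * k + 2)"
    by (simp flip: power_mult power_add add: algebra_simps)
  also have "\<dots> \<le> m ^ (4 * (k + 1))"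
    using assms(1) by (intro power_increasing) auto
  also have "\<dots> \<le> 2 ^ n" by (rule assms(2))
  finally have *: "3 * (m + 1) ^ k * 2 ^ k \<le> 2 ^ n" .
  have "(2::nat) ^ k \<le> 3 * (m + 1) ^ k * 2 ^ k" by simp
  hence "(2::nat) ^ k \<le> 2 ^ n" using * by linarith
  \<comment> \<open>Subtraction truncates, so this precedes the splitting of
    \<open>2 ^ n\<close>.\<close>
  hence "k \<le> n" by simp
  hence "(2::nat) ^ n = 2 ^ (n - k) * 2 ^ k" by (simp flip: power_add)
  thus ?thesis using * by simp
qed

text \<open>Every small \<open>S\<close> gets the weakest bound, that for size \<open>k\<close>;
  scaling by \<open>2 ^ (n - k)\<close> keeps the count in the naturals.\<close>

lemma card_some_small_set_sums_to_ones:
  assumes gb: "good_base n m R" and m: "m \<ge> 2" "m ^ (4 * (k + 1)) \<le> 2 ^ n"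
  shows "3 * card {r \<in> R. \<exists>S\<subseteq>{..<m}. card S \<le> k \<and> sums_to_ones n S r} \<le> card R"
proof -
  define F where "F = {S. S \<subseteq> {..<m} \<and> card S \<le> k}"
  have "finite F" by (simp add: F_def)
  have "card {r \<in> R. \<exists>S\<subseteq>{..<m}. card S \<le> k \<and> sums_to_ones n S r}
      = card (\<Union>S\<in>F. {r \<in> R. sums_to_ones n S r})"
    by (rule arg_cong[of _ _ card]) (auto simp: F_def)
  also have "\<dots> \<le> (\<Sum>S\<in>F. card {r \<in> R. sums_to_ones n S r})"
    by (rule card_UN_le[OF \<open>finite F\<close>])
  finally have "card {r \<in> R. \<exists>S\<subseteq>{..<m}. card S \<le> k \<and> sums_to_ones n S r} * 2 ^ (n - k)
      \<le> (\<Sum>S\<in>F. card {r \<in> R. sums_to_ones n S r} * 2 ^ (n - k))"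
    by (simp flip: sum_distrib_right)
  also have "\<dots> \<le> (\<Sum>S\<in>F. card R)"
  proof (rule sum_mono)
    fix S assume S: "S \<in> F"
    have "card {r \<in> R. sums_to_ones n S r} * 2 ^ (n - k)
        \<le> card {r \<in> R. sums_to_ones n S r} * 2 ^ (n - card S)"
      using S by (intro mult_le_mono2 power_increasing) (auto simp: F_def)
    also have "\<dots> \<le> card R" using S by (intro card_sums_to_ones[OF gb]) (auto simp: F_def)
    finally show "card {r \<in> R. sums_to_ones n S r} * 2 ^ (n - k) \<le> card R" .
  qed
  also have "\<dots> \<le> (m + 1) ^ k * card R"
    using card_small_subsets[of m k] by (simp add: F_def)
  finally have "3 * card {r \<in> R. \<exists>S\<subseteq>{..<m}. card S \<le> k \<and> sums_to_ones n S r} * 2 ^ (n - k)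
      \<le> (3 * (m + 1) ^ k) * card R" by simp
  also have "\<dots> \<le> card R * 2 ^ (n - k)"
    using mult_le_mono1[OF union_bound_arith[OF m]] by (simp add: mult.commute)
  finally show ?thesis by simp
qed

theorem theorem3p4:
  fixes n m :: nat and R :: "bool list list set" and d :: real
  assumes "good_base n m R"
    and "d = real n / (4 * log 2 (real m)) - 1"
  shows "measure_pmf.prob (pmf_of_set R)
    {r. \<forall>\<epsilon><1/2. \<forall>p. real (cube_degree m p) \<le> d \<longrightarrow>
          (\<exists>y\<in>D_set n r. \<bar>p y - of_bool (PUR n r y)\<bar> > \<epsilon>)} \<ge> 2/3"
    (is "measure_pmf.prob _ ?G \<ge> _")
proof (cases "d < 0")
  case True
  \<comment> \<open>No degree is negative, so the condition is vacuous.\<close>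
  hence "?G = UNIV" by auto
  thus ?thesis by simp
next
  case False
  have "m \<ge> 2"
  proof (rule ccontr)
    assume "\<not> m \<ge> 2"
    hence "m = 0 \<or> m = 1" by auto
    \<comment> \<open>The logarithm is 0 for both values of \<open>m\<close>, and division by 0
      gives 0.\<close>
    hence "d = -1" using assms(2) by (auto simp: log_def)
    thus False using False by simp
  qed
  \<comment> \<open>Degrees are integers, so rounding \<open>d\<close> down loses no
    polynomial.\<close>
  define k where "k = nat \<lfloor>d\<rfloor>"
  have le_k: "cube_degree m p \<le> k" if "real (cube_degree m p) \<le> d" for p
    using that by (simp add: k_def le_nat_floor)
  have "log 2 (real m) > 0" using \<open>m \<ge> 2\<close> by simp
  \<comment> \<open>The \<open>- 1\<close> in \<open>d\<close> becomes the \<open>+ 1\<close> here;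
    clearing the denominator and exponentiating gives the hypothesis of the union bound.\<close>
  moreover have "real k + 1 \<le> real n / (4 * log 2 (real m))"
    using False assms(2) by (simp add: k_def)
  ultimately have "real (4 * (k + 1)) * log 2 (real m) \<le> real n"
    by (simp add: field_simps)
  hence "log 2 (real m ^ (4 * (k + 1))) \<le> real n"
    using \<open>m \<ge> 2\<close> by (simp only: log_nat_power)
  hence "real m ^ (4 * (k + 1)) \<le> 2 powr real n"
    using \<open>m \<ge> 2\<close> by (subst (asm) log_le_iff) auto
  hence "real (m ^ (4 * (k + 1))) \<le> real (2 ^ n)"
    by (simp add: powr_realpow)
  hence "m ^ (4 * (k + 1)) \<le> 2 ^ n" by (simp only: of_nat_le_iff)
  note bad = card_some_small_set_sums_to_ones[OF assms(1) \<open>m \<ge> 2\<close> this]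
  define B where "B = {r \<in> R. \<exists>S\<subseteq>{..<m}. card S \<le> k \<and> sums_to_ones n S r}"
  have fin: "finite R" "R \<noteq> {}" using good_base_finite[OF assms(1)] by auto
  have "R - B \<subseteq> R \<inter> ?G"
  proof
    fix r assume r: "r \<in> R - B"
    hence "r \<in> R" "\<And>S. S \<subseteq> {..<m} \<Longrightarrow> card S \<le> k \<Longrightarrow> \<not> sums_to_ones n S r"
      by (auto simp: B_def)
    from PUR_inapproximable[OF assms(1) this le_k] show "r \<in> R \<inter> ?G"
      using r by blast
  qed
  hence "card (R - B) \<le> card (R \<inter> ?G)" using fin by (intro card_mono) auto
  moreover have "card (R - B) = card R - card B"
    using fin by (intro card_Diff_subset) (auto simp: B_def)
  ultimately have "2 * card R \<le> 3 * card (R \<inter> ?G)"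
    using bad by (simp add: B_def)
  hence "2 * real (card R) \<le> 3 * real (card (R \<inter> ?G))"
    by linarith
  moreover have "card R > 0" using fin by (simp add: card_gt_0_iff)
  ultimately show ?thesis
    using fin by (simp add: measure_pmf_of_set field_simps)
qed

end
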